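(* Let $n$ be a nonnegative integer, $a>0$, let $\nu$ be a real number with $\nu\ge-\tfrac12$, and let $z\in\mathbb{C}\setminus(-\infty,0]$. Then $$\int_0^{2a}\frac{J_\nu(bz)}{\sqrt{4a^2-b^2}}\,T_n\left(\frac{b}{2a}\right)db=\frac{\pi}{2}\,J_{(\nu+n)/2}(az)\,J_{(\nu-n)/2}(az).$$
   Context: $J_\nu$ is the Bessel function of the first kind of order $\nu$ (principal branch on $\mathbb{C}\setminus(-\infty,0]$), and $T_n$ is the Chebyshev polynomial of the first kind, $T_n(\cos\theta)=\cos(n\theta)$. *)

theory Defs
  imports "HOL-Analysis.Analysis" "HOL-Computational_Algebra.Polynomial"
begin

text \<open>
  Ascending series, with the principal branch of the power. The reciprocal Gamma function is entire
  and vanishes at the nonpositive integers, so the formula also covers orders that are negative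
  integers. Because \<open>0 powr \<nu> = 0\<close>, the value at \<open>z = 0\<close> is always 0 (even for \<open>\<nu> = 0\<close>); the origin
  lies on the branch cut and is outside the intended domain.
\<close>

definition bessel_J_term :: "complex \<Rightarrow> complex \<Rightarrow> nat \<Rightarrow> complex" where
  "bessel_J_term \<nu> z k = (- 1) ^ k / fact k * rGamma (\<nu> + of_nat k + 1) * (z / 2) ^ (2 * k)"

definition bessel_J :: "complex \<Rightarrow> complex \<Rightarrow> complex" where
  "bessel_J \<nu> z = (z / 2) powr \<nu> * (\<Sum>k. bessel_J_term \<nu> z k)"

lemma summable_bessel_J_term: "summable (bessel_J_term \<nu> z)"
proof (rule summable_ratio_test)
  define N where "N = nat \<lceil>2 * (norm (z / 2))\<^sup>2\<rceil> + nat \<lceil>norm \<nu>\<rceil>"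
  show "(1 / 2 :: real) < 1" by simp
  fix k assume k: "N \<le> k"
  let ?A = "norm (bessel_J_term \<nu> z (Suc k))" and ?B = "norm (bessel_J_term \<nu> z k)"
  let ?r = "(norm (z / 2))\<^sup>2"
  have k1: "2 * ?r \<le> real k" and k2: "norm \<nu> \<le> real k"
    using k unfolding N_def by linarith+
  have k1': "2 * ?r \<le> real k + 1"
    using k1 by linarith
  have "real k + 1 = norm (of_nat (k + 1) :: complex)"
    by (subst norm_of_nat) simp
  also have "\<dots> \<le> norm (\<nu> + of_nat k + 1) + norm \<nu>"
    using norm_triangle_ineq4[of "\<nu> + of_nat k + 1" \<nu>] by (simp add: add.commute)
  finally have n1: "1 \<le> norm (\<nu> + of_nat k + 1)"
    using k2 by linarith
  have rg: "rGamma (\<nu> + of_nat k + 1) = (\<nu> + of_nat k + 1) * rGamma (\<nu> + of_nat (Suc k) + 1)"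
    using rGamma_plus1[of "\<nu> + of_nat k + 1"] by (simp add: algebra_simps)
  have "- (bessel_J_term \<nu> z (Suc k) * (of_nat (Suc k) * (\<nu> + of_nat k + 1)))
      = bessel_J_term \<nu> z k * (z / 2)\<^sup>2"
    unfolding bessel_J_term_def rg fact_Suc
    by (simp add: power2_eq_square del: of_nat_Suc)
  then have "norm (bessel_J_term \<nu> z (Suc k) * (of_nat (Suc k) * (\<nu> + of_nat k + 1)))
      = norm (bessel_J_term \<nu> z k * (z / 2)\<^sup>2)"
    by (metis norm_minus_cancel)
  then have eq: "?A * ((real k + 1) * norm (\<nu> + of_nat k + 1)) = ?B * ?r"
    by (simp only: norm_mult norm_power norm_of_nat) (simp add: add.commute)
  have "?A * (2 * ?r) \<le> ?A * ((real k + 1) * norm (\<nu> + of_nat k + 1))"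
    using mult_mono[OF k1' n1] by (intro mult_left_mono) auto
  then have le: "?A * (2 * ?r) \<le> ?B * ?r"
    using eq by simp
  show "?A \<le> 1 / 2 * ?B"
  proof (cases "z = 0")
    case True
    then show ?thesis by (simp add: bessel_J_term_def)
  next
    case False
    then have "?r > 0" by simp
    moreover have "(2 * ?A) * ?r \<le> ?B * ?r" using le by (simp add: mult_ac)
    ultimately have "2 * ?A \<le> ?B" by (rule mult_right_le_imp_le[rotated])
    then show ?thesis by simp
  qed
qed

fun chebyshev_T :: "nat \<Rightarrow> real poly" where
  "chebyshev_T 0 = 1"
| "chebyshev_T (Suc 0) = [:0, 1:]"
| "chebyshev_T (Suc (Suc n)) = [:0, 2:] * chebyshev_T (Suc n) - chebyshev_T n"

lemma poly_chebyshev_T_cos: "poly (chebyshev_T n) (cos \<theta>) = cos (real n * \<theta>)"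
proof (induction n rule: chebyshev_T.induct)
  case (3 n)
  have "cos (real (Suc n) * \<theta> + \<theta>) + cos (real (Suc n) * \<theta> - \<theta>)
      = 2 * cos \<theta> * cos (real (Suc n) * \<theta>)"
    by (simp add: cos_add cos_diff)
  moreover have "real (Suc n) * \<theta> + \<theta> = real (Suc (Suc n)) * \<theta>"
    and "real (Suc n) * \<theta> - \<theta> = real n * \<theta>"
    by (simp_all add: algebra_simps)
  ultimately show ?case
    using 3 by (simp add: algebra_simps)
qed simp_all

end

theory Submission
  imports Defs
begin

text \<open>
  Integrating the series of \<open>J\<^sub>\<nu>\<close> term by term reduces the left-hand side to the integrals of
  \<open>b\<^sup>\<mu> T\<^sub>n(b/c) / sqrt (c\<^sup>2 - b\<^sup>2)\<close> with \<open>c = 2a\<close> and \<open>\<mu> = \<nu> + 2k\<close>. For \<open>n = 0\<close> these are Beta integrals, and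
  the three-term recurrence of \<open>T\<^sub>n\<close> extends their closed form to all \<open>n\<close>; written with the
  reciprocal Gamma function, it needs no case distinction at the poles. On the right-hand side,
  Vandermonde's identity evaluates the coefficients of the Cauchy product of the two Bessel series,
  and the two series agree term by term.
\<close>

section \<open>Beta integrals with the weight
  \<open>1 / sqrt (c\<^sup>2 - b\<^sup>2)\<close>\<close>

lemma has_integral_powr_div_sqrt:
  fixes c \<mu> :: real
  assumes c: "c > 0" and \<mu>: "\<mu> > - 1"
  shows "((\<lambda>b. b powr \<mu> / sqrt (c\<^sup>2 - b\<^sup>2)) has_integral
           c powr \<mu> / 2 * Beta ((\<mu> + 1) / 2) (1 / 2)) {0..c}"
proof -
  \<comment> \<open>The substitution t = (b/c)^2, dt = 2b/c^2 db, leads to a Beta integrand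
    \<open>h\<close>; the constant in \<open>f\<close> absorbs the powers of \<open>c\<close> and
    the factor 2 of the derivative.\<close>
  define h where "h = (\<lambda>t::real. t powr ((\<mu> + 1) / 2 - 1) * (1 - t) powr (1 / 2 - 1))"
  define f where "f = (\<lambda>t::real. c powr \<mu> / 2 * h t)"
  define g where "g = (\<lambda>b::real. (b / c)\<^sup>2)"
  let ?I = "c powr \<mu> / 2 * Beta ((\<mu> + 1) / 2) (1 / 2)"
  have img: "g ` {0<..<c} = {0<..<1}"
  proof (intro equalityI subsetI)
    fix y assume "y \<in> g ` {0<..<c}"
    then show "y \<in> {0<..<1}" using c by (auto simp: g_def power_less_one_iff)
  next
    fix y :: real assume y: "y \<in> {0<..<1}"
    then have "y = g (c * sqrt y)" and "c * sqrt y \<in> {0<..<c}"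
      using c by (auto simp: g_def)
    then show "y \<in> g ` {0<..<c}" by blast
  qed
  have "(h has_integral Beta ((\<mu> + 1) / 2) (1 / 2)) {0..1}"
    unfolding h_def using \<mu> by (intro has_integral_Beta_real) auto
  then have "(f has_integral ?I) {0..1}"
    unfolding f_def by (intro has_integral_mult_right)
  \<comment> \<open>Dropping the endpoints changes no integral and keeps both b and c^2 - b^2
    positive.\<close>
  then have f: "(f has_integral ?I) (g ` {0<..<c})"
    by (simp add: has_integral_Icc_iff_Ioo img)
  have "f absolutely_integrable_on (g ` {0<..<c})"
    using f by (intro nonnegative_absolutely_integrable_1) (auto simp: f_def h_def)
  then have "(\<lambda>b. \<bar>2 * b / c\<^sup>2\<bar> * f (g b)) absolutely_integrable_on {0<..<c}
      \<and> integral {0<..<c} (\<lambda>b. \<bar>2 * b / c\<^sup>2\<bar> * f (g b)) = ?I"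
    using f c
  proof (subst has_absolute_integral_change_of_variables_1'[where g = g])
    show "(g has_field_derivative 2 * b / c\<^sup>2) (at b within {0<..<c})" for b
      unfolding g_def using c by (auto intro!: derivative_eq_intros simp: power2_eq_square)
    show "inj_on g {0<..<c}"
      using c by (auto simp: g_def inj_on_def power_divide)
  qed (auto simp: integral_unique)
  then have "((\<lambda>b. \<bar>2 * b / c\<^sup>2\<bar> * f (g b)) has_integral ?I) {0<..<c}"
    by (metis (no_types) has_integral_iff set_lebesgue_integral_eq_integral(1))
  also have "?this \<longleftrightarrow> ((\<lambda>b. b powr \<mu> / sqrt (c\<^sup>2 - b\<^sup>2)) has_integral ?I) {0<..<c}"
  proof (rule has_integral_cong)
    fix b assume b: "b \<in> {0<..<c}"
    have lt: "b\<^sup>2 < c\<^sup>2" using b by (intro power_strict_mono) auto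
    have "(g b) powr ((\<mu> + 1) / 2 - 1) = ((b / c) powr 2) powr ((\<mu> + 1) / 2 - 1)"
      using b c by (simp add: g_def)
    also have "\<dots> = (b / c) powr (\<mu> - 1)"
      unfolding powr_powr by (rule arg_cong[where f = "(powr) (b / c)"]) (simp add: field_simps)
    also have "\<dots> = b powr \<mu> / c powr \<mu> * (c / b)"
      using b c by (simp add: powr_diff powr_divide)
    finally have 1: "(g b) powr ((\<mu> + 1) / 2 - 1) = b powr \<mu> / c powr \<mu> * (c / b)" .
    have "1 - g b = (c\<^sup>2 - b\<^sup>2) / c\<^sup>2"
      using c by (simp add: g_def field_simps)
    then have 2: "(1 - g b) powr (1 / 2 - 1) = c / sqrt (c\<^sup>2 - b\<^sup>2)"
      using c lt
      by (simp add: powr_minus powr_half_sqrt real_sqrt_divide)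
    have "h (g b) = b powr \<mu> / c powr \<mu> * (c / b) * (c / sqrt (c\<^sup>2 - b\<^sup>2))"
      unfolding h_def 1 2 ..
    then show "\<bar>2 * b / c\<^sup>2\<bar> * f (g b) = b powr \<mu> / sqrt (c\<^sup>2 - b\<^sup>2)"
      using b c by (simp add: f_def power2_eq_square)
  qed
  finally show ?thesis by (simp add: has_integral_Icc_iff_Ioo)
qed

text \<open>Legendre duplication trades Gamma((\<mu>+1)/2) for Gamma(\<mu>+1) and a second
  reciprocal Gamma factor. This is the shape that the closed form for general n takes at n =
  0.\<close>

lemma Beta_half_eq_rGamma:
  fixes \<mu> :: real
  assumes "\<mu> > - 1"
  shows "Beta ((\<mu> + 1) / 2) (1 / 2) = pi * (1 / 2) powr \<mu> * Gamma (\<mu> + 1) * (rGamma (\<mu> / 2 + 1))\<^sup>2"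
proof -
  have eq: "(\<mu> + 1) / 2 + 1 / 2 = \<mu> / 2 + 1" and eq2: "2 * ((\<mu> + 1) / 2) = \<mu> + 1"
    by (simp_all add: field_simps)
  have G: "Gamma (\<mu> / 2 + 1) > 0" using assms by (intro Gamma_real_pos) auto
  have "Gamma ((\<mu> + 1) / 2) * Gamma (\<mu> / 2 + 1) = exp ((1 - (\<mu> + 1)) * ln 2) * sqrt pi * Gamma (\<mu> + 1)"
  proof -
    have nonpos: "of_real x \<notin> (\<int>\<^sub>\<le>\<^sub>0 :: complex set)" if "x > 0" for x :: real
      using that by (auto elim!: nonpos_Ints_cases simp: complex_eq_iff)
    have eq': "complex_of_real ((\<mu> + 1) / 2) + 1 / 2 = of_real (\<mu> / 2 + 1)"
      by (simp add: field_simps)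
    \<comment> \<open>Duplication at x = (\<mu>+1)/2, so that x + 1/2 = \<mu>/2 + 1 and 2x = \<mu> +
      1. Both x and x + 1/2 are positive since \<mu> > -1, hence away from the poles.\<close>
    have "Gamma (complex_of_real ((\<mu> + 1) / 2)) * Gamma (complex_of_real ((\<mu> + 1) / 2) + 1 / 2)
        = exp ((1 - 2 * complex_of_real ((\<mu> + 1) / 2)) * of_real (ln 2)) * of_real (sqrt pi)
            * Gamma (2 * complex_of_real ((\<mu> + 1) / 2))"
    proof (rule Gamma_legendre_duplication)
      show "complex_of_real ((\<mu> + 1) / 2) \<notin> \<int>\<^sub>\<le>\<^sub>0"
        using assms by (intro nonpos) simp
      show "complex_of_real ((\<mu> + 1) / 2) + 1 / 2 \<notin> \<int>\<^sub>\<le>\<^sub>0"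
        unfolding eq' using assms by (intro nonpos) simp
    qed
    also note eq'
    also have "2 * complex_of_real ((\<mu> + 1) / 2) = of_real (\<mu> + 1)"
      by simp
    finally have "complex_of_real (Gamma ((\<mu> + 1) / 2) * Gamma (\<mu> / 2 + 1))
        = of_real (exp ((1 - (\<mu> + 1)) * ln 2) * sqrt pi * Gamma (\<mu> + 1))"
      unfolding Gamma_complex_of_real by (simp flip: exp_of_real)
    then show ?thesis
      by (simp only: of_real_eq_iff)
  qed
  also have "exp ((1 - (\<mu> + 1)) * ln 2) = (1 / 2) powr \<mu>"
    by (simp add: powr_def ln_div)
  finally have "Gamma ((\<mu> + 1) / 2) = (1 / 2) powr \<mu> * sqrt pi * Gamma (\<mu> + 1) * rGamma (\<mu> / 2 + 1)"
    using G by (simp add: rGamma_inverse_Gamma field_simps)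
  then show ?thesis
    by (simp add: Beta_altdef eq Gamma_one_half_real power2_eq_square)
qed

section \<open>Moments of the Chebyshev polynomials\<close>

text \<open>Closed form of the integral of b^\<mu> T_n(b/c) / sqrt(c^2 - b^2) over [0, c]. For \<mu>
  > -1 its last factor vanishes exactly when n - \<mu> is a positive even integer, which for integer
  \<mu> is the orthogonality of T_n to lower powers of equal parity.\<close>

definition chebyshev_moment :: "real \<Rightarrow> nat \<Rightarrow> real \<Rightarrow> real" where
  "chebyshev_moment c n \<mu> = pi / 2 * (c / 2) powr \<mu> * Gamma (\<mu> + 1)
     * rGamma ((\<mu> + real n) / 2 + 1) * rGamma ((\<mu> - real n) / 2 + 1)"

text \<open>Counterpart of T_1(x) = x: the factor b/c raises the exponent by one.\<close>

lemma chebyshev_moment_Suc_0: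
  assumes "c > 0" "\<mu> > - 1"
  shows "chebyshev_moment c (Suc 0) \<mu> = chebyshev_moment c 0 (\<mu> + 1) / c"
proof -
  have 1: "Gamma (\<mu> + 1 + 1) = (\<mu> + 1) * Gamma (\<mu> + 1)"
    using assms by (intro Gamma_plus1) (auto elim!: nonpos_Ints_cases)
  have 2: "rGamma ((\<mu> - 1) / 2 + 1) = (\<mu> + 1) / 2 * rGamma ((\<mu> + 1) / 2 + 1)"
    using rGamma_plus1[of "(\<mu> + 1) / 2"] by (simp add: field_simps)
  show ?thesis
    using assms unfolding chebyshev_moment_def of_nat_Suc of_nat_0 add_0_right diff_zero 1 2
    by (simp add: powr_add 2)
qed

text \<open>Counterpart of T_{n+2} = 2x T_{n+1} - T_n. Once
  \<open>rGamma (s + 1) * rGamma (t + 1)\<close> and the other common factors are extracted, it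
  reads t = (s + t) - s, where s + t = \<mu> + 1.\<close>

lemma chebyshev_moment_Suc_Suc:
  assumes "c > 0" "\<mu> > - 1"
  shows "chebyshev_moment c (Suc (Suc n)) \<mu>
           = 2 / c * chebyshev_moment c (Suc n) (\<mu> + 1) - chebyshev_moment c n \<mu>"
proof -
  define s where "s = (\<mu> + real n) / 2 + 1"
  define t where "t = (\<mu> - real n) / 2"
  have 1: "Gamma (\<mu> + 1 + 1) = (s + t) * Gamma (\<mu> + 1)"
    using assms by (subst Gamma_plus1) (auto elim!: nonpos_Ints_cases simp: s_def t_def field_simps)
  have args: "(\<mu> + real (Suc (Suc n))) / 2 + 1 = s + 1" "(\<mu> - real (Suc (Suc n))) / 2 + 1 = t"
    "(\<mu> + 1 + real (Suc n)) / 2 + 1 = s + 1" "(\<mu> + 1 - real (Suc n)) / 2 + 1 = t + 1"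
    "(\<mu> + real n) / 2 + 1 = s" "(\<mu> - real n) / 2 + 1 = t + 1"
    by (simp_all add: s_def t_def field_simps)
  have 2: "rGamma s = s * rGamma (s + 1)" "rGamma t = t * rGamma (t + 1)"
    by (simp_all add: rGamma_plus1)
  show ?thesis
    unfolding chebyshev_moment_def args 1 2
    using assms by (simp add: powr_add algebra_simps)
qed

lemma has_integral_chebyshev_moment:
  assumes c: "c > 0" and "\<mu> > - 1"
  shows "((\<lambda>b. b powr \<mu> / sqrt (c\<^sup>2 - b\<^sup>2) * poly (chebyshev_T n) (b / c))
           has_integral chebyshev_moment c n \<mu>) {0..c}"
  using assms(2)
\<comment> \<open>\<open>\<mu>\<close> is generalised because the recurrence uses the moment of
  T_{n+1} at exponent \<mu> + 1.\<close>
proof (induction n arbitrary: \<mu> rule: chebyshev_T.induct)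
  case (1 \<mu>)
  have "c powr \<mu> / 2 * Beta ((\<mu> + 1) / 2) (1 / 2) = chebyshev_moment c 0 \<mu>"
    using c by (simp add: Beta_half_eq_rGamma 1 chebyshev_moment_def powr_divide power2_eq_square)
  then show ?case
    using has_integral_powr_div_sqrt[OF c 1] by simp
next
  case (2 \<mu>)
  have "((\<lambda>b. b powr (\<mu> + 1) / sqrt (c\<^sup>2 - b\<^sup>2) / c) has_integral chebyshev_moment c 0 (\<mu> + 1) / c) {0..c}"
  proof (intro has_integral_divide)
    have "c powr (\<mu> + 1) / 2 * Beta ((\<mu> + 1 + 1) / 2) (1 / 2) = chebyshev_moment c 0 (\<mu> + 1)"
      using c 2 by (subst Beta_half_eq_rGamma)
        (simp_all add: chebyshev_moment_def powr_divide power2_eq_square)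
    then show "((\<lambda>b. b powr (\<mu> + 1) / sqrt (c\<^sup>2 - b\<^sup>2)) has_integral chebyshev_moment c 0 (\<mu> + 1)) {0..c}"
      using has_integral_powr_div_sqrt[OF c, of "\<mu> + 1"] 2 by simp
  qed
  then show ?case
    using c 2
    by (subst chebyshev_moment_Suc_0)
       (auto elim!: has_integral_eq[rotated] simp: powr_add)
next
  case (3 n \<mu>)
  have "((\<lambda>b. 2 / c * (b powr (\<mu> + 1) / sqrt (c\<^sup>2 - b\<^sup>2) * poly (chebyshev_T (Suc n)) (b / c))
             - b powr \<mu> / sqrt (c\<^sup>2 - b\<^sup>2) * poly (chebyshev_T n) (b / c))
        has_integral chebyshev_moment c (Suc (Suc n)) \<mu>) {0..c}"
    unfolding chebyshev_moment_Suc_Suc[OF c 3(3)]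
    by (intro has_integral_diff has_integral_mult_right 3) (use 3(3) in auto)
  then show ?case
    by (elim has_integral_eq[rotated])
       (use c in \<open>auto simp: powr_add algebra_simps diff_divide_distrib\<close>)
qed

section \<open>Bounds used for dominated convergence and for the Cauchy product\<close>

lemma abs_poly_chebyshev_T_le_1:
  assumes "\<bar>x\<bar> \<le> 1"
  shows "\<bar>poly (chebyshev_T n) x\<bar> \<le> 1"
  using poly_chebyshev_T_cos[of n "arccos x"] assms by (simp add: cos_arccos_abs)

text \<open>The series is a power series in (z/2)^2. It converges at a point of larger modulus, |z|
  + 1 in place of z, hence absolutely at z.\<close>

lemma summable_norm_bessel_J_term: "summable (\<lambda>k. norm (bessel_J_term \<nu> z k))"
proof -
  define coeff :: "nat \<Rightarrow> complex" where
    "coeff k = (- 1) ^ k / fact k * rGamma (\<nu> + of_nat k + 1)" for k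
  have eq: "bessel_J_term \<nu> w = (\<lambda>k. coeff k * ((w / 2)\<^sup>2) ^ k)" for w
    by (auto simp: bessel_J_term_def coeff_def power_mult)
  define w where "w = complex_of_real (norm z + 1)"
  have "norm w = norm z + 1"
    unfolding w_def norm_of_real by simp
  then have "norm ((z / 2)\<^sup>2) < norm ((w / 2)\<^sup>2)"
    by (simp add: norm_power norm_divide power_strict_mono)
  then show ?thesis
    using powser_insidea[of coeff "(w / 2)\<^sup>2" "(z / 2)\<^sup>2"] summable_bessel_J_term[of \<nu> w]
    by (simp add: eq)
qed

lemma norm_bessel_J_term_mono:
  assumes "norm w \<le> norm z"
  shows "norm (bessel_J_term \<nu> w k) \<le> norm (bessel_J_term \<nu> z k)"
  unfolding bessel_J_term_def norm_mult
  using assms by (intro mult_left_mono) (auto simp: norm_power norm_divide intro!: power_mono)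

section \<open>Product of two Bessel functions\<close>

text \<open>Extracting the two reciprocal Gamma factors of index k leaves a product of generalised
  binomial coefficients, which Vandermonde's identity sums. No Gamma value is divided by, so
  \<alpha> and \<beta> are arbitrary.\<close>

lemma sum_rGamma_products:
  fixes \<alpha> \<beta> :: complex
  shows "(\<Sum>j\<le>k. rGamma (\<alpha> + of_nat j + 1) / fact j
              * (rGamma (\<beta> + of_nat (k - j) + 1) / fact (k - j)))
       = pochhammer (\<alpha> + \<beta> + of_nat k + 1) k / fact k
              * rGamma (\<alpha> + of_nat k + 1) * rGamma (\<beta> + of_nat k + 1)"
proof -
  let ?R = "rGamma (\<alpha> + of_nat k + 1) * rGamma (\<beta> + of_nat k + 1)"
  have "(\<Sum>j\<le>k. rGamma (\<alpha> + of_nat j + 1) / fact j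
              * (rGamma (\<beta> + of_nat (k - j) + 1) / fact (k - j)))
      = (\<Sum>j\<le>k. ((\<beta> + of_nat k) gchoose j) * ((\<alpha> + of_nat k) gchoose (k - j)) * ?R)"
  proof (intro sum.cong refl)
    fix j assume "j \<in> {..k}"
    then have j: "j \<le> k" by simp
    \<comment> \<open>Going from index j up to k takes k - j factors, so the binomial of \<alpha>
      has lower index k - j, and that of \<beta> has j.\<close>
    have "rGamma (\<alpha> + of_nat j + 1)
        = pochhammer (\<alpha> + of_nat j + 1) (k - j) * rGamma (\<alpha> + of_nat k + 1)"
      using pochhammer_rGamma[of "\<alpha> + of_nat j + 1" "k - j"] j
      by (simp add: of_nat_diff algebra_simps)
    moreover have "rGamma (\<beta> + of_nat (k - j) + 1)
        = pochhammer (\<beta> + of_nat (k - j) + 1) j * rGamma (\<beta> + of_nat k + 1)"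
      using pochhammer_rGamma[of "\<beta> + of_nat (k - j) + 1" j] j
      by (simp add: of_nat_diff algebra_simps)
    ultimately show "rGamma (\<alpha> + of_nat j + 1) / fact j
              * (rGamma (\<beta> + of_nat (k - j) + 1) / fact (k - j))
        = ((\<beta> + of_nat k) gchoose j) * ((\<alpha> + of_nat k) gchoose (k - j)) * ?R"
      using j by (simp add: gbinomial_pochhammer' of_nat_diff add_diff_eq)
  qed
  also have "\<dots> = ((\<beta> + of_nat k + (\<alpha> + of_nat k)) gchoose k) * ?R"
    by (simp only: gbinomial_Vandermonde [symmetric] sum_distrib_right atLeast0AtMost)
  also have "(\<beta> + of_nat k + (\<alpha> + of_nat k)) gchoose k = pochhammer (\<alpha> + \<beta> + of_nat k + 1) k / fact k"
    by (simp add: gbinomial_pochhammer' add_ac)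
  finally show ?thesis by simp
qed

text \<open>Cauchy product of the two ascending series. The principal powers have the same base z/2,
  so their exponents add.\<close>

lemma bessel_J_mult_sums:
  assumes "z \<noteq> 0"
  shows "(\<lambda>k. (z / 2) powr (\<alpha> + \<beta>) * ((- 1) ^ k * (z / 2) ^ (2 * k)
            * (pochhammer (\<alpha> + \<beta> + of_nat k + 1) k / fact k
               * rGamma (\<alpha> + of_nat k + 1) * rGamma (\<beta> + of_nat k + 1))))
         sums (bessel_J \<alpha> z * bessel_J \<beta> z)"
proof -
  have "(\<Sum>j\<le>k. bessel_J_term \<alpha> z j * bessel_J_term \<beta> z (k - j))
      = (- 1) ^ k * (z / 2) ^ (2 * k) * (pochhammer (\<alpha> + \<beta> + of_nat k + 1) k / fact k
          * rGamma (\<alpha> + of_nat k + 1) * rGamma (\<beta> + of_nat k + 1))" for k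
    unfolding sum_rGamma_products [symmetric] sum_distrib_left
  proof (intro sum.cong refl)
    fix j assume "j \<in> {..k}"
    then have "2 * k = 2 * j + 2 * (k - j)"
      and "(- 1 :: complex) ^ k = (- 1) ^ j * (- 1) ^ (k - j)"
      by (simp_all flip: power_add)
    moreover from this(1) have "(z / 2) ^ (2 * k) = (z / 2) ^ (2 * j) * (z / 2) ^ (2 * (k - j))"
      by (metis power_add)
    ultimately show "bessel_J_term \<alpha> z j * bessel_J_term \<beta> z (k - j)
        = (- 1) ^ k * (z / 2) ^ (2 * k) * (rGamma (\<alpha> + of_nat j + 1) / fact j
              * (rGamma (\<beta> + of_nat (k - j) + 1) / fact (k - j)))"
      by (simp add: bessel_J_term_def)
  qed
  then have "(\<lambda>k. (- 1) ^ k * (z / 2) ^ (2 * k) * (pochhammer (\<alpha> + \<beta> + of_nat k + 1) k / fact k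
          * rGamma (\<alpha> + of_nat k + 1) * rGamma (\<beta> + of_nat k + 1)))
      sums ((\<Sum>k. bessel_J_term \<alpha> z k) * (\<Sum>k. bessel_J_term \<beta> z k))"
    using Cauchy_product_sums[OF summable_norm_bessel_J_term summable_norm_bessel_J_term, of \<alpha> z \<beta> z]
    by simp
  from sums_mult[OF this, of "(z / 2) powr (\<alpha> + \<beta>)"] show ?thesis
    by (simp add: bessel_J_def powr_add mult_ac)
qed


section \<open>Termwise integration of the Bessel series\<close>

lemma bessel_J_term_scaleR:
  "bessel_J_term \<nu> (of_real b * z) k = of_real (b ^ (2 * k)) * bessel_J_term \<nu> z k"
  by (simp add: bessel_J_term_def power_mult_distrib power_divide)

text \<open>Dominated convergence: on [0, c] all partial sums are bounded by a constant multiple of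
  the integrable weight \<open>g\<close>, since |T_n| <= 1 there and the series at bz is dominated
  by the one at cz.\<close>

lemma bessel_J_chebyshev_integral_sums:
  fixes n :: nat and c \<nu> :: real and z :: complex
  assumes c: "c > 0" and \<nu>: "\<nu> > - 1"
  defines "f \<equiv> \<lambda>b::real. bessel_J (of_real \<nu>) (of_real b * z) / of_real (sqrt (c\<^sup>2 - b\<^sup>2))
                     * of_real (poly (chebyshev_T n) (b / c))"
  shows "f absolutely_integrable_on {0..c}"
    and "(\<lambda>k. (z / 2) powr of_real \<nu> * bessel_J_term (of_real \<nu>) z k
               * of_real (chebyshev_moment c n (\<nu> + 2 * real k))) sums integral {0..c} f"
proof -
  define w where "w = (z / 2) powr (complex_of_real \<nu>)"
  define g where "g = (\<lambda>b. b powr \<nu> / sqrt (c\<^sup>2 - b\<^sup>2))"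
  define \<Phi> where "\<Phi> = (\<lambda>b. w * of_real (g b * poly (chebyshev_T n) (b / c)))"
  define F where "F = (\<lambda>N b. \<Sum>k<N. \<Phi> b * bessel_J_term (of_real \<nu>) (of_real b * z) k)"
  define M where "M = (\<Sum>k. norm (bessel_J_term (of_real \<nu>) (of_real c * z) k))"
  define J where "J = (\<lambda>N. \<Sum>k<N. w * bessel_J_term (of_real \<nu>) z k
                       * of_real (chebyshev_moment c n (\<nu> + 2 * real k)))"
  \<comment> \<open>A nonnegative real factor does not change the branch, so (bz/2)^\<nu> splits. At
    b = 0 both sides are 0 by the convention \<open>0 powr \<nu> = 0\<close>.\<close>
  have f_eq: "f b = \<Phi> b * (\<Sum>k. bessel_J_term (of_real \<nu>) (of_real b * z) k)" if "b \<in> {0..c}" for b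
  proof -
    have "(of_real b * z / 2) powr complex_of_real \<nu> = of_real b powr of_real \<nu> * w"
      unfolding w_def using that by (subst powr_times_real_left [symmetric]) auto
    then have "(of_real b * z / 2) powr complex_of_real \<nu> = of_real (b powr \<nu>) * w"
      using that by (simp add: powr_of_real)
    then show ?thesis
      by (simp add: f_def \<Phi>_def g_def bessel_J_def)
  qed
  have g: "g integrable_on {0..c}"
    unfolding g_def using has_integral_powr_div_sqrt[OF c \<nu>] by blast
  have F_int: "(F N has_integral J N) {0..c}" for N
    unfolding F_def J_def
  proof (intro has_integral_sum)
    fix k
    have "((\<lambda>b. w * bessel_J_term (of_real \<nu>) z k * of_real (b powr (\<nu> + 2 * real k) / sqrt (c\<^sup>2 - b\<^sup>2)
               * poly (chebyshev_T n) (b / c)))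
           has_integral w * bessel_J_term (of_real \<nu>) z k
               * of_real (chebyshev_moment c n (\<nu> + 2 * real k))) {0..c}"
      using \<nu> c by (intro has_integral_mult_right has_integral_of_real has_integral_chebyshev_moment) auto
    then show "((\<lambda>b. \<Phi> b * bessel_J_term (of_real \<nu>) (of_real b * z) k)
           has_integral w * bessel_J_term (of_real \<nu>) z k
               * of_real (chebyshev_moment c n (\<nu> + 2 * real k))) {0..c}"
    proof (elim has_integral_eq[rotated])
      fix b assume "b \<in> {0..c}"
      then have "b powr (\<nu> + 2 * real k) = b powr \<nu> * b ^ (2 * k)"
        \<comment> \<open>At b = 0 both sides are 0, also for \<nu> = k = 0, because
          \<open>0 powr x = 0\<close> for every x.\<close>
        by (cases "b = 0") (auto simp: powr_add simp flip: powr_realpow)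
      then show "w * bessel_J_term (of_real \<nu>) z k * of_real (b powr (\<nu> + 2 * real k) / sqrt (c\<^sup>2 - b\<^sup>2)
               * poly (chebyshev_T n) (b / c))
          = \<Phi> b * bessel_J_term (of_real \<nu>) (of_real b * z) k"
        by (simp add: \<Phi>_def g_def bessel_J_term_scaleR)
    qed
  qed simp
  have F_bound: "norm (F N b) \<le> norm w * M * g b" if b: "b \<in> {0..c}" for N b
  proof -
    have g0: "g b \<ge> 0" using b by (auto simp: g_def intro!: divide_nonneg_nonneg power_mono)
    have "\<bar>poly (chebyshev_T n) (b / c)\<bar> \<le> 1"
      using b c by (intro abs_poly_chebyshev_T_le_1) auto
    then have \<Phi>: "norm (\<Phi> b) \<le> norm w * g b"
      using g0 by (simp add: \<Phi>_def norm_mult abs_mult mult_left_le mult_left_mono)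
    have "(\<Sum>k<N. norm (bessel_J_term (of_real \<nu>) (of_real b * z) k))
        \<le> (\<Sum>k<N. norm (bessel_J_term (of_real \<nu>) (of_real c * z) k))"
      using b by (intro sum_mono norm_bessel_J_term_mono) (auto simp: norm_mult mult_right_mono)
    also have "\<dots> \<le> M"
      unfolding M_def by (intro sum_le_suminf summable_norm_bessel_J_term) auto
    finally have M: "(\<Sum>k<N. norm (bessel_J_term (of_real \<nu>) (of_real b * z) k)) \<le> M" .
    have "norm (F N b) \<le> (\<Sum>k<N. norm (\<Phi> b) * norm (bessel_J_term (of_real \<nu>) (of_real b * z) k))"
      unfolding F_def norm_mult [symmetric] by (rule norm_sum)
    also have "\<dots> \<le> (norm w * g b) * M"
      unfolding sum_distrib_left [symmetric] using g0
      by (intro mult_mono \<Phi> M) (auto intro!: sum_nonneg)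
    finally show ?thesis by (simp add: mult_ac)
  qed
  have F_lim: "(\<lambda>N. F N b) \<longlonglongrightarrow> f b" if "b \<in> {0..c}" for b
    using sums_mult[OF summable_sums[OF summable_bessel_J_term], of "\<Phi> b"] f_eq[OF that]
    by (simp add: F_def sums_def)
  have h: "(\<lambda>b. norm w * M * g b) integrable_on {0..c}"
    by (intro integrable_on_mult_right g)
  note conv = dominated_convergence[of F "{0..c}" "\<lambda>b. norm w * M * g b" f, OF _ h F_bound F_lim]
  \<comment> \<open>The bound passes to the pointwise limit, which upgrades integrability of
    \<open>f\<close> to absolute integrability.\<close>
  have "norm (f b) \<le> norm w * M * g b" if "b \<in> {0..c}" for b
    using F_lim[OF that] F_bound[OF that]
    by (intro Lim_bounded[OF tendsto_norm, of "\<lambda>N. F N b" _ 0]) auto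
  then show "f absolutely_integrable_on {0..c}"
    using F_int by (intro absolutely_integrable_integrable_bound[OF _ conv(1) h]) blast+
  have "(\<lambda>N. integral {0..c} (F N)) \<longlonglongrightarrow> integral {0..c} f"
    using F_int by (intro conv(2)) blast
  then show "(\<lambda>k. (z / 2) powr of_real \<nu> * bessel_J_term (of_real \<nu>) z k
               * of_real (chebyshev_moment c n (\<nu> + 2 * real k))) sums integral {0..c} f"
    unfolding sums_def w_def [symmetric] J_def [symmetric] integral_unique[OF F_int] .
qed

section \<open>Comparison of the two series\<close>

theorem theorem31:
  fixes n :: nat and a \<nu> :: real and z :: complex
  assumes "a > 0" and "\<nu> \<ge> - 1 / 2" and "z \<notin> \<real>\<^sub>\<le>\<^sub>0"
  defines "f \<equiv> \<lambda>b::real. bessel_J (of_real \<nu>) (of_real b * z) / of_real (sqrt (4 * a\<^sup>2 - b\<^sup>2))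
                     * of_real (poly (chebyshev_T n) (b / (2 * a)))"
  shows "f absolutely_integrable_on {0..2 * a} \<and>
         integral {0..2 * a} f
           = of_real (pi / 2) * bessel_J (of_real ((\<nu> + real n) / 2)) (of_real a * z)
                              * bessel_J (of_real ((\<nu> - real n) / 2)) (of_real a * z)"
proof -
  let ?\<alpha> = "complex_of_real ((\<nu> + real n) / 2)" and ?\<beta> = "complex_of_real ((\<nu> - real n) / 2)"
  let ?w = "complex_of_real a * z"
  \<comment> \<open>Terms of the product series with orders (\<nu>+n)/2 and (\<nu>-n)/2 at az. The
    orders add up to \<nu>, so the power in front is independent of n.\<close>
  define P where "P = (\<lambda>k. (?w / 2) powr (?\<alpha> + ?\<beta>) * ((- 1) ^ k * (?w / 2) ^ (2 * k)
            * (pochhammer (?\<alpha> + ?\<beta> + of_nat k + 1) k / fact k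
               * rGamma (?\<alpha> + of_nat k + 1) * rGamma (?\<beta> + of_nat k + 1))))"
  have c: "2 * a > 0" and \<nu>: "\<nu> > - 1" and "?w \<noteq> 0"
    using assms(1-3) by auto
  have f_eq: "f = (\<lambda>b. bessel_J (of_real \<nu>) (of_real b * z) / of_real (sqrt ((2 * a)\<^sup>2 - b\<^sup>2))
                     * of_real (poly (chebyshev_T n) (b / (2 * a))))"
    by (simp add: f_def)
  note aux = bessel_J_chebyshev_integral_sums[OF c \<nu>, of z n, folded f_eq]
  have sum_eq: "?\<alpha> + ?\<beta> = of_real \<nu>"
    by (simp add: field_simps)
  have "(z / 2) powr of_real \<nu> * bessel_J_term (of_real \<nu>) z k
          * of_real (chebyshev_moment (2 * a) n (\<nu> + 2 * real k)) = of_real (pi / 2) * P k" for k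
  proof -
    have "Gamma (\<nu> + 2 * real k + 1) \<noteq> 0"
      using \<nu> by (intro Gamma_real_pos[THEN less_imp_neq, symmetric]) auto
    \<comment> \<open>The Bessel coefficient times the Gamma factor of the moment at exponent \<nu>
      + 2k is a ratio of Gamma values k steps apart, which is the Pochhammer factor produced by
      Vandermonde.\<close>
    then have "rGamma (\<nu> + real k + 1) * Gamma (\<nu> + 2 * real k + 1) = pochhammer (\<nu> + real k + 1) k"
      using pochhammer_rGamma[of "\<nu> + real k + 1" k]
      by (simp add: rGamma_inverse_Gamma algebra_simps)
    then have "complex_of_real (rGamma (\<nu> + real k + 1) * Gamma (\<nu> + 2 * real k + 1))
        = of_real (pochhammer (\<nu> + real k + 1) k)"
      by (rule arg_cong)
    then have 1: "rGamma (complex_of_real \<nu> + of_nat k + 1) * of_real (Gamma (\<nu> + 2 * real k + 1))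
        = pochhammer (complex_of_real \<nu> + of_nat k + 1) k"
      by (simp flip: pochhammer_of_real rGamma_complex_of_real)
    have 2: "(2 * a / 2) powr (\<nu> + 2 * real k) = a powr \<nu> * a ^ (2 * k)"
      using assms(1-3) by (simp add: powr_add flip: powr_realpow)
    have "(?w / 2) powr of_real \<nu> = of_real a powr of_real \<nu> * (z / 2) powr of_real \<nu>"
      using assms(1-3) by (subst powr_times_real_left [symmetric]) auto
    then have 3: "(?w / 2) powr of_real \<nu> = of_real (a powr \<nu>) * (z / 2) powr of_real \<nu>"
      using assms(1-3) by (simp add: powr_of_real)
    \<comment> \<open>With \<mu> = \<nu> + 2k, the arguments \<alpha> + k + 1 and \<beta> + k + 1
      are (\<mu>+n)/2 + 1 and (\<mu>-n)/2 + 1, those in the moment.\<close>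
    have 4: "rGamma (?\<alpha> + of_nat k + 1) = of_real (rGamma ((\<nu> + 2 * real k + real n) / 2 + 1))"
      by (simp add: add_divide_distrib algebra_simps flip: rGamma_complex_of_real)
    have 5: "rGamma (?\<beta> + of_nat k + 1) = of_real (rGamma ((\<nu> + 2 * real k - real n) / 2 + 1))"
      by (simp add: add_divide_distrib diff_divide_distrib algebra_simps flip: rGamma_complex_of_real)
    show ?thesis
      unfolding P_def sum_eq chebyshev_moment_def bessel_J_term_def 2 3 4 5 1 [symmetric]
      by (simp add: power_mult_distrib power_divide mult_ac)
  qed
  then have "(\<lambda>k. of_real (pi / 2) * P k) sums integral {0..2 * a} f"
    using aux(2) by (simp only:)
  moreover have "(\<lambda>k. of_real (pi / 2) * P k) sums (of_real (pi / 2) * (bessel_J ?\<alpha> ?w * bessel_J ?\<beta> ?w))"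
    unfolding P_def by (intro sums_mult bessel_J_mult_sums \<open>?w \<noteq> 0\<close>)
  ultimately have "integral {0..2 * a} f = of_real (pi / 2) * (bessel_J ?\<alpha> ?w * bessel_J ?\<beta> ?w)"
    by (rule sums_unique2)
  with aux(1) show ?thesis by (simp only: mult.assoc simp_thms)
qed

end
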